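(* Let $n\ge 1$ be a positive integer. Suppose $L$ is an isometry in $\mathfrak{L}_n$ for which $\mathcal{H}_n\ominus L\mathcal{H}_n$ contains the range of an isometry $X$ in $\mathfrak{L}_n$. Then $L$ has proper factorizations in $\mathfrak{L}_n$.
   Context: Let $\mathcal{F}_n$ be the unital free semigroup on $n$ generators $z_1,\dots,z_n$ (its unit is the empty word $1$), and let $\mathcal{H}_n=\ell_2(\mathcal{F}_n)$, with orthonormal basis $\{\xi_w: w\in\mathcal{F}_n\}$. Let $L_i$ be the isometry on $\mathcal{H}_n$ with $L_i\xi_v=\xi_{z_iv}$. The non-commutative analytic Toeplitz algebra $\mathfrak{L}_n$ is the unital algebra, closed in the weak operator topology, generated by $L_1,\dots,L_n$ in $\mathcal{B}(\mathcal{H}_n)$. An operator $L\in\mathfrak{L}_n$ has a proper factorization in $\mathfrak{L}_n$ if $L=BC$ for some $B,C\in\mathfrak{L}_n$, neither of which is invertible. *)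

theory Defs
  imports "HOL-Analysis.Analysis"
begin

section \<open>The complex Hilbert space of square-summable families\<close>

typedef 'a ell2 = "{f :: 'a \<Rightarrow> complex. (\<lambda>i. (cmod (f i))\<^sup>2) summable_on UNIV}"
  morphisms coord Abs_ell2
  by (rule exI[of _ "\<lambda>_. 0"]) simp

setup_lifting type_definition_ell2

lemma coord_summable: "(\<lambda>i. (cmod (coord x i))\<^sup>2) summable_on UNIV"
  using coord[of x] by simp

lemma ell2_eqI: "(\<And>i. coord x i = coord y i) \<Longrightarrow> x = y"
  by (simp add: coord_inject[symmetric] fun_eq_iff)

lemma square_summable_add:
  fixes f g :: "'a \<Rightarrow> complex"
  assumes "(\<lambda>i. (cmod (f i))\<^sup>2) summable_on UNIV" "(\<lambda>i. (cmod (g i))\<^sup>2) summable_on UNIV"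
  shows "(\<lambda>i. (cmod (f i + g i))\<^sup>2) summable_on UNIV"
proof (rule summable_on_comparison_test)
  show "(\<lambda>i. 2 * (cmod (f i))\<^sup>2 + 2 * (cmod (g i))\<^sup>2) summable_on UNIV"
    by (intro summable_on_add summable_on_cmult_right assms)
  fix i
  have "(cmod (f i + g i))\<^sup>2 \<le> (cmod (f i) + cmod (g i))\<^sup>2"
    by (simp add: norm_triangle_ineq power_mono)
  also have "\<dots> \<le> 2 * (cmod (f i))\<^sup>2 + 2 * (cmod (g i))\<^sup>2"
    using zero_le_power2[of "cmod (f i) - cmod (g i)"]
    by (simp add: power2_eq_square algebra_simps)
  finally show "(cmod (f i + g i))\<^sup>2 \<le> 2 * (cmod (f i))\<^sup>2 + 2 * (cmod (g i))\<^sup>2" .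
qed simp

lemma square_summable_cmult:
  fixes f :: "'a \<Rightarrow> complex"
  assumes "(\<lambda>i. (cmod (f i))\<^sup>2) summable_on UNIV"
  shows "(\<lambda>i. (cmod (c * f i))\<^sup>2) summable_on UNIV"
  using summable_on_cmult_right[OF assms, of "(cmod c)\<^sup>2"]
  by (simp add: norm_mult power_mult_distrib)

lift_definition cscale :: "complex \<Rightarrow> 'a ell2 \<Rightarrow> 'a ell2" is "\<lambda>c f i. c * f i"
  using square_summable_cmult by blast

text \<open>The inner product is conjugate-linear in the first argument.\<close>

definition cinner :: "'a ell2 \<Rightarrow> 'a ell2 \<Rightarrow> complex" where
  "cinner x y = (\<Sum>\<^sub>\<infinity>i. cnj (coord x i) * coord y i)"

lemma cinner_summable: "(\<lambda>i. cnj (coord x i) * coord y i) summable_on UNIV"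
proof (rule abs_summable_summable, rule summable_on_comparison_test)
  show "(\<lambda>i. (cmod (coord x i))\<^sup>2 + (cmod (coord y i))\<^sup>2) summable_on UNIV"
    by (intro summable_on_add coord_summable)
  fix i
  have "2 * (cmod (coord x i) * cmod (coord y i)) \<le> (cmod (coord x i))\<^sup>2 + (cmod (coord y i))\<^sup>2"
    using zero_le_power2[of "cmod (coord x i) - cmod (coord y i)"]
    by (simp add: power2_eq_square algebra_simps)
  moreover have "0 \<le> cmod (coord x i) * cmod (coord y i)" by simp
  ultimately have "cmod (coord x i) * cmod (coord y i) \<le> (cmod (coord x i))\<^sup>2 + (cmod (coord y i))\<^sup>2"
    by linarith
  then show "cmod (cnj (coord x i) * coord y i) \<le> (cmod (coord x i))\<^sup>2 + (cmod (coord y i))\<^sup>2"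
    by (simp add: norm_mult)
qed simp

instantiation ell2 :: (type) real_vector
begin

lift_definition zero_ell2 :: "'a ell2" is "\<lambda>_. 0" by simp
lift_definition plus_ell2 :: "'a ell2 \<Rightarrow> 'a ell2 \<Rightarrow> 'a ell2" is "\<lambda>f g i. f i + g i"
  using square_summable_add by blast
lift_definition uminus_ell2 :: "'a ell2 \<Rightarrow> 'a ell2" is "\<lambda>f i. - f i" by simp
definition minus_ell2 :: "'a ell2 \<Rightarrow> 'a ell2 \<Rightarrow> 'a ell2" where "minus_ell2 x y = x + (- y)"
definition scaleR_ell2 :: "real \<Rightarrow> 'a ell2 \<Rightarrow> 'a ell2" where
  "scaleR_ell2 r x = cscale (complex_of_real r) x"

instance
proof
  fix a b :: real and x y z :: "'a ell2"
  show "x + y + z = x + (y + z)" by transfer (simp add: algebra_simps)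
  show "x + y = y + x" by transfer (simp add: algebra_simps)
  show "0 + x = x" by transfer simp
  show "- x + x = 0" by transfer simp
  show "x - y = x + - y" by (simp add: minus_ell2_def)
  show "a *\<^sub>R (x + y) = a *\<^sub>R x + a *\<^sub>R y"
    unfolding scaleR_ell2_def by transfer (simp add: algebra_simps)
  show "(a + b) *\<^sub>R x = a *\<^sub>R x + b *\<^sub>R x"
    unfolding scaleR_ell2_def by transfer (simp add: algebra_simps)
  show "a *\<^sub>R b *\<^sub>R x = (a * b) *\<^sub>R x"
    unfolding scaleR_ell2_def by transfer (simp add: algebra_simps)
  show "1 *\<^sub>R x = x"
    unfolding scaleR_ell2_def by transfer simp
qed

end

lemma coord_simps [simp]:
  "coord 0 i = 0"
  "coord (x + y) i = coord x i + coord y i"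
  "coord (- x) i = - coord x i"
  "coord (x - y) i = coord x i - coord y i"
  "coord (r *\<^sub>R x) i = complex_of_real r * coord x i"
  "coord (cscale c x) i = c * coord x i"
  unfolding minus_ell2_def scaleR_ell2_def
  by (simp_all add: zero_ell2.rep_eq plus_ell2.rep_eq uminus_ell2.rep_eq cscale.rep_eq
      del: add_uminus_conv_diff)

lemma cinner_self: "cinner x x = complex_of_real (\<Sum>\<^sub>\<infinity>i. (cmod (coord x i))\<^sup>2)"
proof -
  have "cinner x x = (\<Sum>\<^sub>\<infinity>i. complex_of_real ((cmod (coord x i))\<^sup>2))"
    unfolding cinner_def
    by (rule infsum_cong) (simp add: complex_norm_square mult.commute del: of_real_power)
  also have "\<dots> = complex_of_real (\<Sum>\<^sub>\<infinity>i. (cmod (coord x i))\<^sup>2)"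
    by (intro infsumI has_sum_of_real has_sum_infsum coord_summable)
  finally show ?thesis .
qed

lemma cinner_add_left: "cinner (x + y) z = cinner x z + cinner y z"
  unfolding cinner_def
  by (subst infsum_add[symmetric, OF cinner_summable cinner_summable], rule infsum_cong)
     (simp add: distrib_right)

lemma cinner_cscale_left: "cinner (cscale c x) y = cnj c * cinner x y"
  unfolding cinner_def
  by (subst infsum_cmult_right'[symmetric], rule infsum_cong) (simp add: mult.assoc)

lemma cinner_commute: "cinner x y = cnj (cinner y x)"
proof -
  have "cnj (cinner y x) = (\<Sum>\<^sub>\<infinity>i. cnj (cnj (coord y i) * coord x i))"
    unfolding cinner_def by (rule infsum_cnj[symmetric])
  also have "\<dots> = cinner x y"
    unfolding cinner_def by (rule infsum_cong) simp
  finally show ?thesis by simp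
qed

instantiation ell2 :: (type) real_inner
begin

definition inner_ell2 :: "'a ell2 \<Rightarrow> 'a ell2 \<Rightarrow> real" where
  "inner_ell2 x y = Re (cinner x y)"
definition norm_ell2 :: "'a ell2 \<Rightarrow> real" where
  "norm_ell2 x = sqrt (inner x x)"
definition dist_ell2 :: "'a ell2 \<Rightarrow> 'a ell2 \<Rightarrow> real" where
  "dist_ell2 x y = norm (x - y)"
definition sgn_ell2 :: "'a ell2 \<Rightarrow> 'a ell2" where
  "sgn_ell2 x = inverse (norm x) *\<^sub>R x"
definition uniformity_ell2 :: "('a ell2 \<times> 'a ell2) filter" where
  "uniformity_ell2 = (INF e\<in>{0<..}. principal {(x, y). dist x y < e})"
definition open_ell2 :: "'a ell2 set \<Rightarrow> bool" where
  "open_ell2 U \<longleftrightarrow> (\<forall>x\<in>U. eventually (\<lambda>(x', y). x' = x \<longrightarrow> y \<in> U) uniformity)"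

instance
proof
  fix r :: real and x y z :: "'a ell2" and U :: "'a ell2 set"
  show "dist x y = norm (x - y)" by (rule dist_ell2_def)
  show "sgn x = inverse (norm x) *\<^sub>R x" by (rule sgn_ell2_def)
  show "uniformity = (INF e\<in>{0<..}. principal {(x, y :: 'a ell2). dist x y < e})"
    by (rule uniformity_ell2_def)
  show "open U \<longleftrightarrow> (\<forall>x\<in>U. eventually (\<lambda>(x', y). x' = x \<longrightarrow> y \<in> U) uniformity)"
    by (rule open_ell2_def)
  show "inner x y = inner y x"
    unfolding inner_ell2_def using cinner_commute[of x y] by simp
  show "inner (x + y) z = inner x z + inner y z"
    by (simp add: inner_ell2_def cinner_add_left)
  show "inner (r *\<^sub>R x) y = r * inner x y"
    by (simp add: inner_ell2_def scaleR_ell2_def cinner_cscale_left)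
  show "0 \<le> inner x x"
    by (simp add: inner_ell2_def cinner_self infsum_nonneg)
  show "inner x x = 0 \<longleftrightarrow> x = 0"
  proof
    assume "inner x x = 0"
    then have *: "(\<Sum>\<^sub>\<infinity>i. (cmod (coord x i))\<^sup>2) = 0"
      by (simp add: inner_ell2_def cinner_self)
    have "(cmod (coord x i))\<^sup>2 = 0" for i
      by (rule nonneg_infsum_le_0D[where A = UNIV]) (use * coord_summable in auto)
    then show "x = 0" by (intro ell2_eqI) simp
  qed (simp add: inner_ell2_def cinner_self)
  show "norm x = sqrt (inner x x)" by (rule norm_ell2_def)
qed

end

lemma norm_ell2_sqrt: "norm x = sqrt (\<Sum>\<^sub>\<infinity>i. (cmod (coord x i))\<^sup>2)"
  by (simp add: norm_ell2_def inner_ell2_def cinner_self)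

lemma cscale_add: "cscale c (x + y) = cscale c x + cscale c y"
  by (rule ell2_eqI) (simp add: algebra_simps)

lemma norm_cscale: "norm (cscale c x) = cmod c * norm x"
proof -
  have "inner (cscale c x) (cscale c x) = (cmod c)\<^sup>2 * inner x x"
    by (simp add: inner_ell2_def cinner_self norm_mult power_mult_distrib infsum_cmult_right')
  then show ?thesis by (simp add: norm_ell2_def real_sqrt_mult)
qed

lemma bounded_linear_cscale: "bounded_linear (cscale c)"
  by (rule bounded_linear_intro[where K = "cmod c"])
     (auto simp: cscale_add norm_cscale mult.commute intro!: ell2_eqI)

section \<open>Bounded operators and the weak operator topology\<close>

text \<open>
  The type \<open>'a ell2 \<Rightarrow>\<^sub>L 'a ell2\<close> consists of the bounded real-linear maps;
  \<open>B(H)\<close> is its subset of complex-linear ones.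
\<close>

definition bounded_ops :: "('a ell2 \<Rightarrow>\<^sub>L 'a ell2) set" where
  "bounded_ops = {T. \<forall>c x. blinfun_apply T (cscale c x) = cscale c (blinfun_apply T x)}"

definition op_scale :: "complex \<Rightarrow> ('a ell2 \<Rightarrow>\<^sub>L 'a ell2) \<Rightarrow> ('a ell2 \<Rightarrow>\<^sub>L 'a ell2)" where
  "op_scale c T = Blinfun (\<lambda>x. cscale c (blinfun_apply T x))"

lemma op_scale_apply: "blinfun_apply (op_scale c T) x = cscale c (blinfun_apply T x)"
  unfolding op_scale_def
  by (simp add: bounded_linear_Blinfun_apply
      bounded_linear_compose[OF bounded_linear_cscale blinfun.bounded_linear_right])

definition weak_operator_topology :: "('a ell2 \<Rightarrow>\<^sub>L 'a ell2) topology" where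
  "weak_operator_topology = topology_generated_by
     {{T \<in> bounded_ops. cinner x (blinfun_apply T y) \<in> U} | x y U. open U}"

lemma topspace_weak_operator_topology: "topspace weak_operator_topology = bounded_ops"
proof -
  have "bounded_ops \<in> {{T \<in> bounded_ops. cinner x (blinfun_apply T y) \<in> U} | x y U. open U}"
    by (rule CollectI, rule exI[of _ 0], rule exI[of _ 0], rule exI[of _ UNIV]) simp
  then show ?thesis
    unfolding weak_operator_topology_def topology_generated_by_topspace by blast
qed

definition unital_subalgebra :: "('a ell2 \<Rightarrow>\<^sub>L 'a ell2) set \<Rightarrow> bool" where
  "unital_subalgebra S \<longleftrightarrow> S \<subseteq> bounded_ops \<and> id_blinfun \<in> S \<and>
     (\<forall>A\<in>S. \<forall>B\<in>S. A + B \<in> S \<and> A o\<^sub>L B \<in> S) \<and> (\<forall>c. \<forall>A\<in>S. op_scale c A \<in> S)"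

definition isometry_op :: "('a ell2 \<Rightarrow>\<^sub>L 'a ell2) \<Rightarrow> bool" where
  "isometry_op T \<longleftrightarrow> T \<in> bounded_ops \<and> (\<forall>x. norm (blinfun_apply T x) = norm x)"

definition invertible_op :: "('a ell2 \<Rightarrow>\<^sub>L 'a ell2) \<Rightarrow> bool" where
  "invertible_op T \<longleftrightarrow> (\<exists>S\<in>bounded_ops. S o\<^sub>L T = id_blinfun \<and> T o\<^sub>L S = id_blinfun)"

definition orthocomplement :: "'a ell2 set \<Rightarrow> 'a ell2 set" where
  "orthocomplement M = {x. \<forall>y\<in>M. cinner y x = 0}"

section \<open>The non-commutative analytic Toeplitz algebra\<close>

text \<open>
  The \<open>n\<close> generators are the elements of a finite type \<open>'n\<close>, so \<open>n = CARD('n)\<close>, and the unital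
  free semigroup on them is the type \<open>'n list\<close> with concatenation; the empty list is the unit.
\<close>

type_synonym 'n fock = "'n list ell2"

lift_definition basis_vec :: "'n list \<Rightarrow> 'n fock" is "\<lambda>w v. if v = w then 1 else 0"
proof -
  fix w :: "'n list"
  have "finite {v \<in> UNIV. (cmod (if v = w then 1 else 0))\<^sup>2 \<noteq> 0}"
    by (rule finite_subset[of _ "{w}"]) auto
  then show "(\<lambda>v. (cmod (if v = w then 1 else 0))\<^sup>2) summable_on UNIV"
    by (rule finite_nonzero_values_imp_summable_on)
qed

text \<open>
  Left creation: the coefficient at \<open>v\<close> moves to \<open>i # v\<close>; words not starting
  with \<open>i\<close> get coefficient \<open>0\<close>.
\<close>

definition shift_coeffs :: "'n \<Rightarrow> ('n list \<Rightarrow> complex) \<Rightarrow> 'n list \<Rightarrow> complex" where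
  "shift_coeffs i f w = (case w of [] \<Rightarrow> 0 | j # v \<Rightarrow> if j = i then f v else 0)"

lemma shift_coeffs_has_sum:
  assumes "((\<lambda>v. (cmod (f v))\<^sup>2) has_sum s) UNIV"
  shows "((\<lambda>w. (cmod (shift_coeffs i f w))\<^sup>2) has_sum s) UNIV"
proof -
  have "((\<lambda>w. (cmod (shift_coeffs i f w))\<^sup>2) has_sum s) (range ((#) i))"
    using assms by (subst has_sum_reindex) (auto simp: shift_coeffs_def o_def)
  moreover have "((\<lambda>w. (cmod (shift_coeffs i f w))\<^sup>2) has_sum s) (range ((#) i)) \<longleftrightarrow>
      ((\<lambda>w. (cmod (shift_coeffs i f w))\<^sup>2) has_sum s) UNIV"
    by (rule has_sum_cong_neutral) (auto simp: shift_coeffs_def split: list.splits)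
  ultimately show ?thesis by blast
qed

lift_definition creation :: "'n \<Rightarrow> 'n fock \<Rightarrow> 'n fock" is shift_coeffs
  using shift_coeffs_has_sum by (fastforce simp: summable_on_def)

lemma norm_creation: "norm (creation i x) = norm x"
proof -
  have "((\<lambda>w. (cmod (coord (creation i x) w))\<^sup>2) has_sum (\<Sum>\<^sub>\<infinity>v. (cmod (coord x v))\<^sup>2)) UNIV"
    unfolding creation.rep_eq
    by (intro shift_coeffs_has_sum has_sum_infsum coord_summable)
  then show ?thesis by (simp add: norm_ell2_sqrt infsumI)
qed

lemma bounded_linear_creation: "bounded_linear (creation i)"
  by (rule bounded_linear_intro[where K = 1])
     (auto simp: norm_creation creation.rep_eq shift_coeffs_def intro!: ell2_eqI split: list.splits)

definition left_creation :: "'n \<Rightarrow> ('n fock \<Rightarrow>\<^sub>L 'n fock)" where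
  "left_creation i = Blinfun (creation i)"

lemma left_creation_apply: "blinfun_apply (left_creation i) x = creation i x"
  by (simp add: left_creation_def bounded_linear_Blinfun_apply bounded_linear_creation)

lemma left_creation_basis_vec: "blinfun_apply (left_creation i) (basis_vec v) = basis_vec (i # v)"
  by (rule ell2_eqI)
     (auto simp: left_creation_apply creation.rep_eq basis_vec.rep_eq shift_coeffs_def
       split: list.splits)

lemma isometry_left_creation: "isometry_op (left_creation i)"
  unfolding isometry_op_def bounded_ops_def
  by (auto simp: left_creation_apply norm_creation creation.rep_eq shift_coeffs_def
      intro!: ell2_eqI split: list.splits)

definition nc_toeplitz_algebra :: "('n::finite fock \<Rightarrow>\<^sub>L 'n fock) set" where
  "nc_toeplitz_algebra = \<Inter>{S. unital_subalgebra S \<and> closedin weak_operator_topology S \<and>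
     range left_creation \<subseteq> S}"

lemma unital_subalgebra_bounded_ops: "unital_subalgebra bounded_ops"
  by (auto simp: unital_subalgebra_def bounded_ops_def blinfun.add_left op_scale_apply cscale_add
      mult.left_commute intro!: ell2_eqI)

lemma nc_toeplitz_algebra_subset_bounded_ops: "nc_toeplitz_algebra \<subseteq> bounded_ops"
proof -
  have "closedin weak_operator_topology bounded_ops"
    using closedin_topspace[of weak_operator_topology] by (simp add: topspace_weak_operator_topology)
  then show ?thesis
    using unital_subalgebra_bounded_ops isometry_left_creation
    by (fastforce simp: nc_toeplitz_algebra_def isometry_op_def)
qed

text \<open>
  Non-invertibility is taken in \<open>B(H)\<close>; it implies non-invertibility within the subalgebra.
\<close>

definition has_proper_factorization :: "('n::finite fock \<Rightarrow>\<^sub>L 'n fock) \<Rightarrow> bool" where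
  "has_proper_factorization L \<longleftrightarrow> (\<exists>B\<in>nc_toeplitz_algebra. \<exists>C\<in>nc_toeplitz_algebra.
     L = B o\<^sub>L C \<and> \<not> invertible_op B \<and> \<not> invertible_op C)"

end

theory Submission
  imports Defs
begin

text \<open>
  Since the range of \<open>X\<close> is orthogonal to that of \<open>L\<close>, the isometries \<open>L, X L, X\<^sup>2 L, \<dots>\<close> have
  pairwise orthogonal ranges. Hence \<open>\<Sum> t\<^sub>k X\<^sup>k L\<close> converges in norm for every square-summable \<open>t\<close>
  (lemma \<open>summable_orbit_op\<close>), although \<open>\<Sum> t\<^sub>k X\<^sup>k\<close> may well diverge. This gap is what the
  factorization exploits: formally
  \<open>L = (1 - X)\<^bsup>1/4\<^esup> \<sqdot> ((1 - X)\<^bsup>-1/4\<^esup> L)\<close>.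
  The coefficients of \<open>(1 - z)\<^bsup>1/4\<^esup>\<close> are absolutely summable and those of \<open>(1 - z)\<^bsup>-1/4\<^esup>\<close>
  are square-summable, so both factors are norm limits of polynomials in \<open>X\<close> and \<open>L\<close>, and
  therefore lie in the algebra. Their product is \<open>L\<close> (lemma \<open>factorization\<close>) because the two
  coefficient sequences are inverse to each other under convolution.

  The right factor is not surjective (lemma \<open>right_factor_not_surj\<close>): its values have orbit
  coefficients in the fixed ratio \<open>1 : 1/4 : \<dots>\<close>. If the left factor had an inverse \<open>S\<close>
  (lemma \<open>left_factor_not_invertible\<close>), then \<open>S\<close> would commute with \<open>X\<close> and map \<open>L x\<close> to
  \<open>(1 - X)\<^bsup>-1/4\<^esup> L x\<close>, so a second application would give a vector with the coefficients of
  \<open>(1 - z)\<^bsup>-1/2\<^esup>\<close> along the orthogonal vectors \<open>X\<^sup>m L x\<close>. These coefficients are not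
  square-summable, which contradicts Bessel's inequality. The same argument works with any
  exponent \<open>\<alpha>\<close> such that \<open>1/4 \<le> \<alpha> < 1/2\<close> in place of \<open>1/4\<close>.

  All coefficients are real, so orthogonality and convergence are studied in the underlying real
  Hilbert space.
\<close>

section \<open>Taylor coefficients of the powers of \<open>1 - z\<close>\<close>

definition one_minus_coeff :: "real \<Rightarrow> nat \<Rightarrow> real" where
  "one_minus_coeff \<alpha> k = (-1) ^ k * (\<alpha> gchoose k)"

lemma one_minus_coeff_0 [simp]: "one_minus_coeff \<alpha> 0 = 1"
  by (simp add: one_minus_coeff_def)

lemma one_minus_coeff_1 [simp]: "one_minus_coeff \<alpha> (Suc 0) = - \<alpha>"
  by (simp add: one_minus_coeff_def)

lemma one_minus_coeff_zero_exponent: "one_minus_coeff 0 m = (if m = 0 then 1 else 0)"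
  by (cases m) (simp_all add: one_minus_coeff_def)

lemma one_minus_coeff_Suc:
  "one_minus_coeff \<alpha> (Suc k) = one_minus_coeff \<alpha> k * ((real k - \<alpha>) / (real k + 1))"
proof -
  have "(\<alpha> gchoose Suc k) * (real k + 1) = (\<alpha> gchoose k) * (\<alpha> - real k)"
    using gbinomial_mult_1[of \<alpha> k] by (simp add: algebra_simps)
  then have "(\<alpha> gchoose Suc k) = (\<alpha> gchoose k) * ((\<alpha> - real k) / (real k + 1))"
    by (simp add: field_simps)
  also have "(\<alpha> - real k) / (real k + 1) = - ((real k - \<alpha>) / (real k + 1))"
    by (simp only: minus_divide_left minus_diff_eq)
  finally show ?thesis
    by (simp add: one_minus_coeff_def)
qed

text \<open>
  This is \<open>(1 - z)\<^bsup>\<alpha>\<^esup> (1 - z)\<^bsup>\<beta>\<^esup> = (1 - z)\<^bsup>\<alpha> + \<beta>\<^esup>\<close> read off coefficientwise, that is,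
  Vandermonde's identity.
\<close>

lemma one_minus_coeff_convolution:
  "(\<Sum>j\<le>m. one_minus_coeff \<alpha> j * one_minus_coeff \<beta> (m - j)) = one_minus_coeff (\<alpha> + \<beta>) m"
proof -
  have "(\<Sum>j\<le>m. one_minus_coeff \<alpha> j * one_minus_coeff \<beta> (m - j)) =
      (\<Sum>j\<le>m. (-1) ^ m * ((\<alpha> gchoose j) * (\<beta> gchoose (m - j))))"
  proof (rule sum.cong)
    fix j assume "j \<in> {..m}"
    then have "(-1::real) ^ m = (-1) ^ j * (-1) ^ (m - j)"
      by (simp flip: power_add)
    then show "one_minus_coeff \<alpha> j * one_minus_coeff \<beta> (m - j) =
        (-1) ^ m * ((\<alpha> gchoose j) * (\<beta> gchoose (m - j)))"
      by (simp add: one_minus_coeff_def)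
  qed simp
  also have "\<dots> = one_minus_coeff (\<alpha> + \<beta>) m"
    using gbinomial_Vandermonde[of \<alpha> \<beta> m]
    by (simp add: one_minus_coeff_def atLeast0AtMost flip: sum_distrib_left)
  finally show ?thesis .
qed

lemma one_minus_coeff_nonneg: "\<alpha> \<le> 0 \<Longrightarrow> 0 \<le> one_minus_coeff \<alpha> k"
  by (induction k) (simp_all add: one_minus_coeff_Suc)

lemma one_minus_coeff_nonpos:
  assumes "0 \<le> \<alpha>" "\<alpha> \<le> 1"
  shows "one_minus_coeff \<alpha> (Suc k) \<le> 0"
proof (induction k)
  case (Suc k)
  then show ?case
    using assms by (subst one_minus_coeff_Suc) (simp add: mult_nonpos_nonneg divide_nonpos_pos)
qed (use assms in simp)

text \<open>
  Partial sums are the coefficients after division by \<open>1 - z\<close>.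
\<close>

lemma one_minus_coeff_sum: "(\<Sum>k\<le>m. one_minus_coeff \<alpha> k) = one_minus_coeff (\<alpha> - 1) m"
  using gbinomial_sum_lower_neg[of \<alpha> m] by (simp add: one_minus_coeff_def mult.commute)

text \<open>
  All coefficients except the first are nonpositive, so the sum of absolute values is twice the
  first coefficient minus the plain sum, whose partial sums are nonnegative.
\<close>

lemma one_minus_coeff_abs_summable:
  assumes "0 \<le> \<alpha>" "\<alpha> \<le> 1"
  shows "summable (\<lambda>k. \<bar>one_minus_coeff \<alpha> k\<bar>)"
proof (rule bounded_imp_summable)
  fix m
  have "\<bar>one_minus_coeff \<alpha> k\<bar> = (if k = 0 then 2 else 0) - one_minus_coeff \<alpha> k" for k
    using one_minus_coeff_nonpos[OF assms, of "k - 1"] by (cases k) auto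
  then have "(\<Sum>k\<le>m. \<bar>one_minus_coeff \<alpha> k\<bar>) = 2 - (\<Sum>k\<le>m. one_minus_coeff \<alpha> k)"
    by (simp add: sum_subtractf)
  then show "(\<Sum>k\<le>m. \<bar>one_minus_coeff \<alpha> k\<bar>) \<le> 2"
    using one_minus_coeff_nonneg[of "\<alpha> - 1" m] assms by (simp add: one_minus_coeff_sum)
qed simp

text \<open>
  The coefficients decay like \<open>k\<^bsup>-3/4\<^esup>\<close>. Taking fourth powers turns this bound into a polynomial
  one, which follows from the recurrence by induction.
\<close>

lemma one_minus_coeff_quarter_bound:
  "one_minus_coeff (-1/4) k ^ 4 * (real k + 1) ^ 3 \<le> 1"
proof (induction k)
  case (Suc k)
  let ?a = "one_minus_coeff (-1/4) k"
  have poly: "(4 * real k + 1) ^ 4 * (real k + 2) ^ 3 \<le> (4 * (real k + 1)) ^ 4 * (real k + 1) ^ 3"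
  proof -
    \<comment> \<open>The difference of the two sides has only positive coefficients.\<close>
    have "(4 * (t + 1)) ^ 4 * (t + 1) ^ 3 = (4 * t + 1) ^ 4 * (t + 2) ^ 3 +
        (672 * t ^ 5 + 3248 * t ^ 4 + 5663 * t ^ 3 + 4410 * t ^ 2 + 1652 * t + 248)" for t :: real
      by algebra
    then show ?thesis by simp
  qed
  have "one_minus_coeff (-1/4) (Suc k) ^ 4 * (real (Suc k) + 1) ^ 3 =
      ?a ^ 4 * ((4 * real k + 1) ^ 4 * (real k + 2) ^ 3) / (4 * (real k + 1)) ^ 4"
    by (simp add: one_minus_coeff_Suc power_mult_distrib power_divide divide_simps)
       (simp add: algebra_simps)
  also have "\<dots> \<le> ?a ^ 4 * ((4 * (real k + 1)) ^ 4 * (real k + 1) ^ 3) / (4 * (real k + 1)) ^ 4"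
    by (intro divide_right_mono mult_left_mono poly) simp_all
  also have "\<dots> = ?a ^ 4 * (real k + 1) ^ 3"
    by simp
  finally show ?case using Suc by linarith
qed simp

lemma one_minus_coeff_square_summable: "summable (\<lambda>k. (one_minus_coeff (-1/4) k)\<^sup>2)"
proof (rule summable_comparison_test)
  show "summable (\<lambda>k. real (Suc k) powr (-3/2))"
    using summable_real_powr_iff[of "-3/2"] by (subst summable_Suc_iff) simp
  have "(one_minus_coeff (-1/4) k)\<^sup>2 \<le> real (Suc k) powr (-3/2)" for k
  proof (rule power2_le_imp_le)
    have "(real (Suc k) powr (-3/2))\<^sup>2 = real (Suc k) powr (-3)"
      by (simp add: power2_eq_square flip: powr_add)
    also have "\<dots> = 1 / (real k + 1) ^ 3"
      by (simp add: powr_minus divide_inverse add.commute)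
    finally have "(real (Suc k) powr (-3/2))\<^sup>2 = 1 / (real k + 1) ^ 3" .
    moreover have "((one_minus_coeff (-1/4) k)\<^sup>2)\<^sup>2 \<le> 1 / (real k + 1) ^ 3"
      using one_minus_coeff_quarter_bound[of k] by (simp add: pos_le_divide_eq)
    ultimately show "((one_minus_coeff (-1/4) k)\<^sup>2)\<^sup>2 \<le> (real (Suc k) powr (-3/2))\<^sup>2"
      by simp
  qed simp
  then show "\<exists>N. \<forall>k\<ge>N. norm ((one_minus_coeff (-1/4) k)\<^sup>2) \<le> real (Suc k) powr (-3/2)"
    by simp
qed

text \<open>
  These coefficients decay like \<open>k\<^bsup>-1/2\<^esup>\<close>. The summand \<open>1\<close> in the factor \<open>4 k + 1\<close>
  makes the bound hold at \<open>k = 0\<close> and still survives the induction step.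
\<close>

lemma one_minus_coeff_half_bound: "1 \<le> (4 * real k + 1) * (one_minus_coeff (-1/2) k)\<^sup>2"
proof (induction k)
  case (Suc k)
  let ?d = "one_minus_coeff (-1/2) k"
  have poly: "(4 * real k + 1) * (2 * (real k + 1))\<^sup>2 \<le> (4 * real k + 5) * (2 * real k + 1)\<^sup>2"
    by (simp add: algebra_simps power2_eq_square)
  have "(4 * real k + 1) * ?d\<^sup>2 =
      ?d\<^sup>2 * ((4 * real k + 1) * (2 * (real k + 1))\<^sup>2) / (2 * (real k + 1))\<^sup>2"
    by simp
  also have "\<dots> \<le> ?d\<^sup>2 * ((4 * real k + 5) * (2 * real k + 1)\<^sup>2) / (2 * (real k + 1))\<^sup>2"
    by (intro divide_right_mono mult_left_mono poly) simp_all
  also have "\<dots> = (4 * real (Suc k) + 1) * (one_minus_coeff (-1/2) (Suc k))\<^sup>2"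
    by (simp add: one_minus_coeff_Suc power_mult_distrib power_divide add.commute divide_simps)
  finally show ?case using Suc by linarith
qed simp

lemma one_minus_coeff_not_square_summable: "\<not> summable (\<lambda>k. (one_minus_coeff (-1/2) k)\<^sup>2)"
proof
  assume "summable (\<lambda>k. (one_minus_coeff (-1/2) k)\<^sup>2)"
  then have *: "summable (\<lambda>k. 4 * (one_minus_coeff (-1/2) k)\<^sup>2)"
    by (rule summable_mult)
  have "summable (\<lambda>k. inverse (real (Suc k)))"
  proof (rule summable_comparison_test[OF _ *], intro exI allI impI)
    fix k :: nat
    have "1 \<le> (4 * (real k + 1)) * (one_minus_coeff (-1/2) k)\<^sup>2"
      using one_minus_coeff_half_bound[of k]
        mult_right_mono[of "4 * real k + 1" "4 * (real k + 1)" "(one_minus_coeff (-1/2) k)\<^sup>2"]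
      by simp
    then show "norm (inverse (real (Suc k))) \<le> 4 * (one_minus_coeff (-1/2) k)\<^sup>2"
      by (simp add: field_simps)
  qed
  then show False
    using not_summable_harmonic[where 'a = real] by (subst (asm) summable_Suc_iff) simp
qed

section \<open>Series generated by two isometries with orthogonal ranges\<close>

primrec op_pow :: "('a::real_normed_vector \<Rightarrow>\<^sub>L 'a) \<Rightarrow> nat \<Rightarrow> ('a \<Rightarrow>\<^sub>L 'a)" where
  "op_pow T 0 = id_blinfun"
| "op_pow T (Suc k) = T o\<^sub>L op_pow T k"

lemma op_pow_add: "op_pow T (j + k) x = op_pow T j (op_pow T k x)"
  by (induction j) simp_all

lemma inner_isometry:
  fixes T :: "'a::real_inner \<Rightarrow>\<^sub>L 'b::real_inner"
  assumes "\<And>x. norm (T x) = norm x"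
  shows "inner (T x) (T y) = inner x y"
  by (simp add: dot_norm assms flip: blinfun.add_right)

lemma blinfun_apply_sums:
  "f sums T \<Longrightarrow> (\<lambda>k. blinfun_apply (f k) x) sums blinfun_apply T x"
  by (rule bounded_linear.sums[OF blinfun.bounded_linear_left])

locale orthogonal_isometries =
  fixes X L :: "'h::{real_inner, banach} \<Rightarrow>\<^sub>L 'h"
  assumes norm_X: "norm (X x) = norm x" and norm_L: "norm (L x) = norm x"
    and orthogonal: "inner (X x) (L y) = 0"
begin

definition orbit_op :: "nat \<Rightarrow> 'h \<Rightarrow>\<^sub>L 'h" where
  "orbit_op k = op_pow X k o\<^sub>L L"

lemma norm_op_pow: "norm (op_pow X k x) = norm x"
  by (induction k) (simp_all add: norm_X)

lemma inner_op_pow: "inner (op_pow X k x) (op_pow X k y) = inner x y"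
  by (rule inner_isometry) (rule norm_op_pow)

lemma orbit_op_add: "orbit_op (j + k) x = op_pow X j (orbit_op k x)"
  by (simp add: orbit_op_def op_pow_add)

text \<open>
  After cancelling \<open>X\<^sup>m\<close> this is an inner product of \<open>L x\<close> with a vector in the range of \<open>X\<close>.
\<close>

lemma inner_orbit_op_shift: "m < j \<Longrightarrow> inner (orbit_op m x) (op_pow X j y) = 0"
proof -
  assume "m < j"
  then obtain i where "j = m + Suc i" by (metis add_Suc_right less_iff_Suc_add)
  then have "inner (orbit_op m x) (op_pow X j y) = inner (L x) (op_pow X (Suc i) y)"
    by (simp only: orbit_op_def op_pow_add inner_op_pow blinfun_apply_blinfun_compose)
  also have "\<dots> = 0"
    using orthogonal by (simp add: inner_commute)
  finally show ?thesis .
qed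

lemma inner_orbit_op: "inner (orbit_op m x) (orbit_op j y) = (if m = j then inner x y else 0)"
proof -
  have *: "inner (orbit_op m x) (orbit_op j y) = 0" if "m < j" for m j x y
    using inner_orbit_op_shift[OF that] by (simp add: orbit_op_def)
  show ?thesis
  proof (cases "m = j")
    case True
    then show ?thesis by (simp add: orbit_op_def inner_op_pow inner_isometry norm_L)
  next
    case False
    then have "inner (orbit_op m x) (orbit_op j y) = 0"
      using * by (metis inner_commute linorder_neqE_nat)
    with False show ?thesis by simp
  qed
qed

lemma norm_sum_orbit_op:
  assumes "finite F"
  shows "(norm ((\<Sum>k\<in>F. t k *\<^sub>R orbit_op k) x))\<^sup>2 = (\<Sum>k\<in>F. (t k)\<^sup>2) * (norm x)\<^sup>2"
proof -
  have "(norm ((\<Sum>k\<in>F. t k *\<^sub>R orbit_op k) x))\<^sup>2 =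
      (\<Sum>j\<in>F. \<Sum>k\<in>F. t j * (t k * inner (orbit_op j x) (orbit_op k x)))"
    by (simp add: power2_norm_eq_inner blinfun.sum_left blinfun.scaleR_left inner_sum_left
        inner_sum_right sum_distrib_left inner_commute mult.left_commute)
  also have "\<dots> = (\<Sum>j\<in>F. (t j)\<^sup>2 * (norm x)\<^sup>2)"
    using assms by (simp add: inner_orbit_op if_distrib power2_norm_eq_inner
        power2_eq_square[of "t _"] mult.assoc cong: if_cong)
  finally show ?thesis by (simp add: sum_distrib_right)
qed

text \<open>
  By the Pythagorean identity a block \<open>\<Sum> t\<^sub>k X\<^sup>k L\<close> has operator norm at most the
  square root of \<open>\<Sum> t\<^sub>k\<^sup>2\<close>.
\<close>

lemma summable_orbit_op:
  assumes "summable (\<lambda>k. (t k)\<^sup>2)"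
  shows "summable (\<lambda>k. t k *\<^sub>R orbit_op k)"
proof (subst summable_Cauchy, intro allI impI)
  fix e :: real assume e: "e > 0"
  then obtain N where N: "\<And>m n. m \<ge> N \<Longrightarrow> norm (\<Sum>k=m..<n. (t k)\<^sup>2) < (e/2)\<^sup>2"
    using assms[unfolded summable_Cauchy, rule_format, of "(e/2)\<^sup>2"] by auto
  have "norm (\<Sum>k=m..<n. t k *\<^sub>R orbit_op k) < e" if "m \<ge> N" for m n
  proof -
    have "norm ((\<Sum>k=m..<n. t k *\<^sub>R orbit_op k) x) \<le> (e/2) * norm x" for x
    proof (rule power2_le_imp_le)
      have "(\<Sum>k=m..<n. (t k)\<^sup>2) \<le> (e/2)\<^sup>2"
        using N[OF that, of n] by simp
      then have "(\<Sum>k=m..<n. (t k)\<^sup>2) * (norm x)\<^sup>2 \<le> (e/2)\<^sup>2 * (norm x)\<^sup>2"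
        by (rule mult_right_mono) simp
      then show "(norm ((\<Sum>k=m..<n. t k *\<^sub>R orbit_op k) x))\<^sup>2 \<le> ((e/2) * norm x)\<^sup>2"
        by (simp only: norm_sum_orbit_op finite_atLeastLessThan power_mult_distrib)
    qed (use e in simp)
    then have "norm (\<Sum>k=m..<n. t k *\<^sub>R orbit_op k) \<le> e/2"
      using e by (intro norm_blinfun_bound) simp_all
    then show ?thesis using e by simp
  qed
  then show "\<exists>N. \<forall>m\<ge>N. \<forall>n. norm (\<Sum>k=m..<n. t k *\<^sub>R orbit_op k) < e" by blast
qed

lemma bessel:
  assumes "norm x = 1"
  shows "(\<Sum>m<N. (inner (orbit_op m x) u)\<^sup>2) \<le> (norm u)\<^sup>2"
proof -
  let ?t = "\<lambda>m. inner (orbit_op m x) u" and ?Q = "\<Sum>m<N. (inner (orbit_op m x) u)\<^sup>2"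
  define w where "w = (\<Sum>m<N. ?t m *\<^sub>R orbit_op m) x"
  have nw: "(norm w)\<^sup>2 = ?Q"
    using norm_sum_orbit_op[of "{..<N}" ?t x] assms by (simp add: w_def)
  have iw: "inner w u = ?Q"
    by (simp add: w_def blinfun.sum_left blinfun.scaleR_left inner_sum_left power2_eq_square)
  have "0 \<le> (norm (u - w))\<^sup>2" by simp
  also have "\<dots> = (norm u)\<^sup>2 - ?Q"
    using nw iw by (simp add: power2_norm_eq_inner inner_diff inner_commute)
  finally show ?thesis by simp
qed

text \<open>
  These are \<open>(1 - X)\<^bsup>1/4\<^esup>\<close> and, for \<open>right_factor\<close>, the formal product \<open>(1 - X)\<^bsup>-1/4\<^esup> L\<close>.
\<close>

definition left_factor :: "'h \<Rightarrow>\<^sub>L 'h" where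
  "left_factor = (\<Sum>k. one_minus_coeff (1/4) k *\<^sub>R op_pow X k)"

definition right_factor :: "'h \<Rightarrow>\<^sub>L 'h" where
  "right_factor = (\<Sum>k. one_minus_coeff (-1/4) k *\<^sub>R orbit_op k)"

lemma left_factor_sums: "(\<lambda>k. one_minus_coeff (1/4) k *\<^sub>R op_pow X k) sums left_factor"
  unfolding left_factor_def
proof (rule summable_sums, rule summable_norm_cancel, rule summable_comparison_test)
  show "summable (\<lambda>k. \<bar>one_minus_coeff (1/4) k\<bar>)"
    by (rule one_minus_coeff_abs_summable) simp_all
  have "norm (op_pow X k) \<le> 1" for k
    by (rule norm_blinfun_bound) (simp_all add: norm_op_pow)
  then show "\<exists>N. \<forall>k\<ge>N. norm (norm (one_minus_coeff (1/4) k *\<^sub>R op_pow X k))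
      \<le> \<bar>one_minus_coeff (1/4) k\<bar>"
    by (simp add: mult_left_le)
qed

lemma right_factor_sums: "(\<lambda>k. one_minus_coeff (-1/4) k *\<^sub>R orbit_op k) sums right_factor"
  unfolding right_factor_def
  by (intro summable_sums summable_orbit_op one_minus_coeff_square_summable)

lemma left_factor_apply_sums: "(\<lambda>k. one_minus_coeff (1/4) k *\<^sub>R op_pow X k x) sums left_factor x"
  using blinfun_apply_sums[OF left_factor_sums, of x] by (simp add: blinfun.scaleR_left)

lemma right_factor_apply_sums: "(\<lambda>k. one_minus_coeff (-1/4) k *\<^sub>R orbit_op k x) sums right_factor x"
  using blinfun_apply_sums[OF right_factor_sums, of x] by (simp add: blinfun.scaleR_left)

lemma inner_orbit_op_right_factor:
  "inner (orbit_op m x) (right_factor x) = one_minus_coeff (-1/4) m * (norm x)\<^sup>2"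
proof -
  have "(\<lambda>k. one_minus_coeff (-1/4) k * inner (orbit_op m x) (orbit_op k x)) sums
      inner (orbit_op m x) (right_factor x)"
    using bounded_linear.sums[OF bounded_linear_inner_right right_factor_apply_sums,
        of "orbit_op m x" x] by simp
  moreover have "(\<lambda>k. one_minus_coeff (-1/4) k * inner (orbit_op m x) (orbit_op k x)) =
      (\<lambda>k. if k = m then one_minus_coeff (-1/4) m * (norm x)\<^sup>2 else 0)"
    by (auto simp: inner_orbit_op power2_norm_eq_inner)
  ultimately show ?thesis
    using sums_unique2[OF _ sums_single[of m "\<lambda>_. one_minus_coeff (-1/4) m * (norm x)\<^sup>2"]] by simp
qed

lemma inner_orbit_op_shifted_right_factor:
  "inner (orbit_op m x) (op_pow X k (right_factor x)) =
    (if k \<le> m then one_minus_coeff (-1/4) (m - k) * (norm x)\<^sup>2 else 0)"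
proof (cases "k \<le> m")
  case True
  then have "orbit_op m x = op_pow X k (orbit_op (m - k) x)" by (simp flip: orbit_op_add)
  with True show ?thesis by (simp add: inner_op_pow inner_orbit_op_right_factor)
qed (simp add: inner_orbit_op_shift)

text \<open>
  Multiplying the right factor by a power series in \<open>X\<close> convolves the orbit coefficients. The
  exponent \<open>1/4\<close> shows that the two factors multiply to \<open>L\<close>; the exponent \<open>-1/4\<close> describes what
  an inverse of the left factor would do. The series of inner products is finite, since
  \<open>X\<^sup>m L x\<close> is orthogonal to the range of \<open>X\<^sup>k\<close> for \<open>k > m\<close>.
\<close>

lemma inner_orbit_op_power_series:
  assumes "(\<lambda>k. one_minus_coeff \<alpha> k *\<^sub>R op_pow X k (right_factor x)) sums y"
  shows "inner (orbit_op m x) y = one_minus_coeff (\<alpha> - 1/4) m * (norm x)\<^sup>2"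
proof -
  let ?f = "\<lambda>k. one_minus_coeff \<alpha> k * inner (orbit_op m x) (op_pow X k (right_factor x))"
  have "?f sums inner (orbit_op m x) y"
    using bounded_linear.sums[OF bounded_linear_inner_right assms, of "orbit_op m x"] by simp
  moreover have "?f sums (\<Sum>k\<le>m. ?f k)"
    by (rule sums_finite) (simp_all add: inner_orbit_op_shifted_right_factor)
  ultimately have "inner (orbit_op m x) y = (\<Sum>k\<le>m. ?f k)"
    by (rule sums_unique2)
  also have "\<dots> = (\<Sum>k\<le>m. one_minus_coeff \<alpha> k * one_minus_coeff (-1/4) (m - k)) * (norm x)\<^sup>2"
    by (simp add: inner_orbit_op_shifted_right_factor sum_distrib_right mult.assoc)
  finally show ?thesis by (simp add: one_minus_coeff_convolution)
qed

text \<open>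
  In other words, \<open>left_factor (right_factor x)\<close> lies in the closed span of the orbit
  \<open>X\<^sup>m L x\<close>. A vector of this span is determined by its inner products with the orbit, which
  removes any need to rearrange the only conditionally convergent double series.
\<close>

lemma inner_product_of_factors_eq_0:
  assumes "\<And>m. inner (orbit_op m x) u = 0"
  shows "inner (left_factor (right_factor x)) u = 0"
proof -
  have left_factor_orbit: "inner (left_factor (orbit_op j x)) u = 0" for j
  proof -
    have "(\<lambda>k. inner (one_minus_coeff (1/4) k *\<^sub>R op_pow X k (orbit_op j x)) u) sums
        inner (left_factor (orbit_op j x)) u"
      by (rule bounded_linear.sums[OF bounded_linear_inner_left left_factor_apply_sums])
    then show ?thesis by (simp add: assms sums_iff flip: orbit_op_add)
  qed
  have "(\<lambda>j. inner (left_factor (one_minus_coeff (-1/4) j *\<^sub>R orbit_op j x)) u) sums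
      inner (left_factor (right_factor x)) u"
    by (intro bounded_linear.sums[OF bounded_linear_inner_left]
        bounded_linear.sums[OF blinfun.bounded_linear_right] right_factor_apply_sums)
  then show ?thesis by (simp add: left_factor_orbit blinfun.scaleR_right sums_iff)
qed

text \<open>
  The difference \<open>u\<close> of the two values at \<open>x\<close> is orthogonal to every \<open>X\<^sup>m L x\<close>, and it lies in the
  closed span of these vectors, so it is orthogonal to itself.
\<close>

lemma factorization: "left_factor o\<^sub>L right_factor = L"
proof (rule blinfun_eqI)
  fix x
  define u where "u = left_factor (right_factor x) - L x"
  have L_orbit: "L x = orbit_op 0 x" by (simp add: orbit_op_def)
  have orbit_u: "inner (orbit_op m x) u = 0" for m
    using inner_orbit_op_power_series[OF left_factor_apply_sums, of m x]
    by (simp add: u_def inner_diff_right L_orbit inner_orbit_op one_minus_coeff_zero_exponent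
        power2_norm_eq_inner)
  have "inner u u = 0"
    using inner_product_of_factors_eq_0[OF orbit_u] orbit_u[of 0]
    by (simp add: u_def inner_diff_left flip: L_orbit)
  then show "(left_factor o\<^sub>L right_factor) x = L x" by (simp add: u_def)
qed

lemma right_factor_not_surj:
  assumes "(x::'h) \<noteq> 0"
  shows "\<not> surj right_factor"
proof
  assume "surj right_factor"
  \<comment> \<open>Values of the right factor have their first two components in the ratio \<open>1 : 1/4\<close>; the
    components of \<open>w\<close> are chosen to annihilate this ratio.\<close>
  define w where "w = orbit_op 1 x - (1/4) *\<^sub>R orbit_op 0 x"
  obtain y where y: "w = right_factor y" using \<open>surj right_factor\<close> by (metis surjD)
  have "(\<lambda>k. one_minus_coeff (-1/4) k * inner w (orbit_op k y)) sums inner w (right_factor y)"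
    using bounded_linear.sums[OF bounded_linear_inner_right right_factor_apply_sums, of w y] by simp
  moreover have "(\<lambda>k. one_minus_coeff (-1/4) k * inner w (orbit_op k y)) sums
      (\<Sum>k\<in>{0,1}. one_minus_coeff (-1/4) k * inner w (orbit_op k y))"
    by (rule sums_finite) (auto simp: w_def inner_diff_left inner_orbit_op)
  moreover have "(\<Sum>k\<in>{0,1}. one_minus_coeff (-1/4) k * inner w (orbit_op k y)) = 0"
    by (simp add: w_def inner_diff_left inner_orbit_op)
  ultimately have "inner w (right_factor y) = 0" by (metis sums_unique2)
  then have "inner w w = 0" by (simp flip: y)
  moreover have "inner w w = 17/16 * inner x x"
    by (simp add: w_def inner_diff inner_orbit_op)
  ultimately show False using assms by simp
qed

lemma left_factor_commute: "left_factor (X x) = X (left_factor x)"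
proof -
  have "op_pow X k (X x) = X (op_pow X k x)" for k
    using op_pow_add[of X k 1 x] op_pow_add[of X 1 k x] by simp
  then have "(\<lambda>k. X (one_minus_coeff (1/4) k *\<^sub>R op_pow X k x)) sums left_factor (X x)"
    using left_factor_apply_sums[of "X x"] by (simp add: blinfun.scaleR_right)
  moreover have "(\<lambda>k. X (one_minus_coeff (1/4) k *\<^sub>R op_pow X k x)) sums X (left_factor x)"
    by (rule bounded_linear.sums[OF blinfun.bounded_linear_right left_factor_apply_sums])
  ultimately show ?thesis by (rule sums_unique2)
qed

text \<open>
  An inverse \<open>S\<close> would have to act as \<open>(1 - X)\<^bsup>-1/4\<^esup>\<close>. Then \<open>S (S (L e))\<close>, that is
  \<open>S (right_factor e)\<close>, would have the coefficients of \<open>(1 - z)\<^bsup>-1/2\<^esup>\<close> along an orthonormal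
  sequence, against Bessel's inequality.
\<close>

lemma left_factor_not_invertible:
  assumes "(x::'h) \<noteq> 0"
    and SB: "S o\<^sub>L left_factor = id_blinfun" and BS: "left_factor o\<^sub>L S = id_blinfun"
  shows False
proof -
  define e where "e = sgn x"
  have e: "norm e = 1" using assms by (simp add: e_def norm_sgn)
  have SB': "S (left_factor y) = y" and BS': "left_factor (S y) = y" for y
    using SB BS by (metis blinfun_apply_blinfun_compose blinfun_apply_id_blinfun)+
  have S_X: "S (X y) = X (S y)" for y
    using left_factor_commute[of "S y"] SB'[of "X (S y)"] by (simp add: BS')
  have S_pow: "S (op_pow X k y) = op_pow X k (S y)" for k y
    by (induction k) (simp_all add: S_X)
  have S_L: "S (L y) = right_factor y" for y
    using SB'[of "right_factor y"] arg_cong[OF factorization, of "\<lambda>T. blinfun_apply T y"] by simp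
  have "(\<lambda>k. S (one_minus_coeff (-1/4) k *\<^sub>R orbit_op k e)) sums S (right_factor e)"
    by (rule bounded_linear.sums[OF blinfun.bounded_linear_right right_factor_apply_sums])
  then have "(\<lambda>k. one_minus_coeff (-1/4) k *\<^sub>R op_pow X k (right_factor e)) sums S (right_factor e)"
    by (simp add: blinfun.scaleR_right orbit_op_def S_pow S_L)
  then have coeff: "inner (orbit_op m e) (S (right_factor e)) = one_minus_coeff (-1/2) m" for m
    using inner_orbit_op_power_series[of "-1/4" e] e by simp
  have "summable (\<lambda>m. (one_minus_coeff (-1/2) m)\<^sup>2)"
    by (rule summableI_nonneg_bounded[where x = "(norm (S (right_factor e)))\<^sup>2"])
       (use bessel[OF e, of "S (right_factor e)"] in \<open>simp_all add: coeff\<close>)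
  then show False using one_minus_coeff_not_square_summable by contradiction
qed

end

section \<open>Completeness of the space of square-summable families\<close>

text \<open>
  Norm balls are closed under coordinatewise limits: each finite partial sum of squares passes to
  the limit. Completeness uses this twice, to place the coordinatewise limit of a Cauchy sequence
  in the space and to upgrade coordinatewise convergence to norm convergence.
\<close>

lemma ell2_coordinate_limit:
  fixes s :: "nat \<Rightarrow> 'a ell2"
  assumes lim: "\<And>i. (\<lambda>n. coord (s n) i) \<longlonglongrightarrow> f i"
    and bound: "eventually (\<lambda>n. norm (s n) \<le> K) sequentially"
  obtains y where "\<And>i. coord y i = f i" "norm y \<le> K"
proof -
  obtain n where "norm (s n) \<le> K"
    using eventually_happens'[OF sequentially_bot bound] by blast
  then have K: "0 \<le> K" by (rule order_trans[OF norm_ge_zero])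
  have fin: "(\<Sum>i\<in>F. (cmod (f i))\<^sup>2) \<le> K\<^sup>2" if F: "finite F" for F
  proof (rule tendsto_upperbound)
    show "(\<lambda>n. \<Sum>i\<in>F. (cmod (coord (s n) i))\<^sup>2) \<longlonglongrightarrow> (\<Sum>i\<in>F. (cmod (f i))\<^sup>2)"
      by (intro tendsto_sum tendsto_power tendsto_norm lim)
    show "eventually (\<lambda>n. (\<Sum>i\<in>F. (cmod (coord (s n) i))\<^sup>2) \<le> K\<^sup>2) sequentially"
      using bound
    proof eventually_elim
      case (elim n)
      have "(\<Sum>i\<in>F. (cmod (coord (s n) i))\<^sup>2) \<le> (\<Sum>\<^sub>\<infinity>i. (cmod (coord (s n) i))\<^sup>2)"
        by (rule finite_sum_le_infsum) (use F coord_summable in auto)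
      also have "\<dots> = (norm (s n))\<^sup>2"
        by (simp add: norm_ell2_sqrt infsum_nonneg)
      also have "\<dots> \<le> K\<^sup>2" using elim by (simp add: power_mono)
      finally show ?case .
    qed
  qed simp
  have summable: "(\<lambda>i. (cmod (f i))\<^sup>2) summable_on UNIV"
    by (rule nonneg_bdd_above_summable_on) (use fin in \<open>auto simp: bdd_above_def\<close>)
  then have coord_y: "coord (Abs_ell2 f) i = f i" for i
    by (simp add: Abs_ell2_inverse)
  have "norm (Abs_ell2 f) \<le> K"
    unfolding norm_ell2_sqrt coord_y
    by (rule real_le_lsqrt) (use K fin summable in \<open>auto intro!: infsum_le_finite_sums infsum_nonneg\<close>)
  with coord_y show thesis by (rule that)
qed

lemma cmod_coord_le_norm: "cmod (coord x i) \<le> norm x"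
proof -
  have "(\<Sum>i\<in>{i}. (cmod (coord x i))\<^sup>2) \<le> (\<Sum>\<^sub>\<infinity>i. (cmod (coord x i))\<^sup>2)"
    by (rule finite_sum_le_infsum) (use coord_summable in auto)
  then show ?thesis by (simp add: norm_ell2_sqrt real_le_rsqrt)
qed

instance ell2 :: (type) banach
proof
  fix s :: "nat \<Rightarrow> 'a ell2" assume s: "Cauchy s"
  have "Cauchy (\<lambda>n. coord (s n) i)" for i
  proof (rule metric_CauchyI)
    fix e :: real assume "e > 0"
    then obtain N where N: "\<And>m n. m \<ge> N \<Longrightarrow> n \<ge> N \<Longrightarrow> dist (s m) (s n) < e"
      using metric_CauchyD[OF s] by blast
    have "dist (coord (s m) i) (coord (s n) i) \<le> dist (s m) (s n)" for m n
      using cmod_coord_le_norm[of "s m - s n" i] by (simp add: dist_norm)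
    then show "\<exists>N. \<forall>m\<ge>N. \<forall>n\<ge>N. dist (coord (s m) i) (coord (s n) i) < e"
      using N by (meson le_less_trans)
  qed
  then have "\<exists>l. (\<lambda>n. coord (s n) i) \<longlonglongrightarrow> l" for i
    using Cauchy_convergent by (auto simp: convergent_def)
  then obtain f where f: "\<And>i. (\<lambda>n. coord (s n) i) \<longlonglongrightarrow> f i" by metis
  obtain K where "\<And>n. norm (s n) \<le> K"
    using Cauchy_Bseq[OF s] by (auto simp: Bseq_def)
  then obtain y where y: "\<And>i. coord y i = f i"
    using ell2_coordinate_limit[OF f, of K] by (metis always_eventually)
  have "s \<longlonglongrightarrow> y"
  proof (rule metric_LIMSEQ_I)
    fix e :: real assume e: "e > 0"
    then obtain N where N: "\<And>m n. m \<ge> N \<Longrightarrow> n \<ge> N \<Longrightarrow> dist (s m) (s n) < e/2"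
      using metric_CauchyD[OF s, of "e/2"] by auto
    have "dist (s m) y < e" if m: "m \<ge> N" for m
    proof -
      have lim: "(\<lambda>n. coord (s m - s n) i) \<longlonglongrightarrow> coord (s m) i - f i" for i
        unfolding coord_simps by (intro tendsto_diff tendsto_const f)
      have "eventually (\<lambda>n. norm (s m - s n) \<le> e/2) sequentially"
        using N[OF m] by (auto simp: eventually_sequentially dist_norm intro!: exI[of _ N] less_imp_le)
      then obtain z where z: "\<And>i. coord z i = coord (s m) i - f i" "norm z \<le> e/2"
        using ell2_coordinate_limit[OF lim] by metis
      then have "z = s m - y" by (intro ell2_eqI) (simp add: y)
      with z(2) e show ?thesis by (simp add: dist_norm)
    qed
    then show "\<exists>N. \<forall>m\<ge>N. dist (s m) y < e" by blast
  qed
  then show "convergent s" by (auto simp: convergent_def)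
qed

section \<open>Norm limits in the non-commutative Toeplitz algebra\<close>

text \<open>
  This reduces the continuity of the complex inner product to that of the real one.
\<close>

lemma cinner_eq_inner:
  "cinner x y = complex_of_real (inner x y) + \<i> * complex_of_real (inner (cscale \<i> x) y)"
  by (simp add: complex_eq_iff inner_ell2_def cinner_cscale_left)

lemma tendsto_cinner_apply:
  assumes "T \<longlonglongrightarrow> (T0 :: 'a ell2 \<Rightarrow>\<^sub>L 'a ell2)"
  shows "(\<lambda>n. cinner x (T n y)) \<longlonglongrightarrow> cinner x (T0 y)"
  unfolding cinner_eq_inner
  by (intro tendsto_intros blinfun.tendsto assms)

lemma bounded_ops_limit:
  assumes "T \<longlonglongrightarrow> T0" and "\<And>n. T n \<in> bounded_ops"
  shows "T0 \<in> bounded_ops"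
proof -
  have "T0 (cscale c x) = cscale c (T0 x)" for c x
  proof (rule LIMSEQ_unique)
    show "(\<lambda>n. T n (cscale c x)) \<longlonglongrightarrow> T0 (cscale c x)"
      by (intro blinfun.tendsto assms tendsto_const)
    have "(\<lambda>n. cscale c (T n x)) \<longlonglongrightarrow> cscale c (T0 x)"
      by (intro bounded_linear.tendsto[OF bounded_linear_cscale] blinfun.tendsto assms tendsto_const)
    then show "(\<lambda>n. T n (cscale c x)) \<longlonglongrightarrow> cscale c (T0 x)"
      using assms(2) by (simp add: bounded_ops_def)
  qed
  then show ?thesis by (simp add: bounded_ops_def)
qed

text \<open>
  The matrix coefficients of \<open>T n\<close> converge, so \<open>T n\<close> is eventually in each subbasic neighbourhood
  of the limit; finite intersections and unions preserve this.
\<close>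

lemma limitin_weak_operator_topology:
  assumes "T \<longlonglongrightarrow> T0" and "\<And>n. T n \<in> bounded_ops"
  shows "limitin weak_operator_topology T T0 sequentially"
proof -
  have T0: "T0 \<in> bounded_ops" by (rule bounded_ops_limit[OF assms])
  have "eventually (\<lambda>n. T n \<in> U) sequentially"
    if "generate_topology_on {{T \<in> bounded_ops. cinner x (T y) \<in> U} | x y U. open U} U" "T0 \<in> U"
    for U
    using that
  proof induction
    case (Basis U)
    then obtain x y V where "open V" and U: "U = {T \<in> bounded_ops. cinner x (T y) \<in> V}"
      by blast
    then show ?case
      using topological_tendstoD[OF tendsto_cinner_apply[OF assms(1), of x y], of V] Basis assms(2)
      by simp
  next
    case (UN \<U>)
    then show ?case by (blast intro: eventually_mono)
  qed (auto intro: eventually_conj)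
  then show ?thesis
    using T0 by (simp add: limitin_def topspace_weak_operator_topology)
      (simp add: weak_operator_topology_def openin_topology_generated_by_iff)
qed

lemma nc_toeplitz_algebra_limit:
  assumes "T \<longlonglongrightarrow> T0" and "\<And>n. T n \<in> nc_toeplitz_algebra"
  shows "T0 \<in> nc_toeplitz_algebra"
  unfolding nc_toeplitz_algebra_def
proof (rule InterI, clarify)
  fix S :: "('a fock \<Rightarrow>\<^sub>L 'a fock) set"
  assume S: "unital_subalgebra S" "closedin weak_operator_topology S" "range left_creation \<subseteq> S"
  then have "T n \<in> S" for n
    using assms(2) by (auto simp: nc_toeplitz_algebra_def)
  moreover have "limitin weak_operator_topology T T0 sequentially"
    using assms nc_toeplitz_algebra_subset_bounded_ops by (intro limitin_weak_operator_topology) auto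
  ultimately show "T0 \<in> S"
    using limitin_closedin[OF _ S(2)] by (metis always_eventually trivial_limit_sequentially)
qed

lemma
  shows nc_toeplitz_algebra_id: "id_blinfun \<in> nc_toeplitz_algebra"
    and nc_toeplitz_algebra_add:
      "S \<in> nc_toeplitz_algebra \<Longrightarrow> T \<in> nc_toeplitz_algebra \<Longrightarrow> S + T \<in> nc_toeplitz_algebra"
    and nc_toeplitz_algebra_compose:
      "S \<in> nc_toeplitz_algebra \<Longrightarrow> T \<in> nc_toeplitz_algebra \<Longrightarrow> S o\<^sub>L T \<in> nc_toeplitz_algebra"
    and nc_toeplitz_algebra_op_scale:
      "T \<in> nc_toeplitz_algebra \<Longrightarrow> op_scale c T \<in> nc_toeplitz_algebra"
  by (simp_all add: nc_toeplitz_algebra_def unital_subalgebra_def)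

lemma nc_toeplitz_algebra_scaleR:
  assumes "T \<in> nc_toeplitz_algebra" shows "r *\<^sub>R T \<in> nc_toeplitz_algebra"
proof -
  have "r *\<^sub>R T = op_scale (complex_of_real r) T"
    by (rule blinfun_eqI) (simp add: blinfun.scaleR_left op_scale_apply scaleR_ell2_def)
  then show ?thesis
    using assms by (simp add: nc_toeplitz_algebra_op_scale)
qed

lemma nc_toeplitz_algebra_sums:
  assumes "T sums T0" and "\<And>k. T k \<in> nc_toeplitz_algebra"
  shows "T0 \<in> nc_toeplitz_algebra"
proof (rule nc_toeplitz_algebra_limit)
  show "(\<lambda>n. \<Sum>k<n. T k) \<longlonglongrightarrow> T0" using assms(1) by (simp add: sums_def)
  have "0 *\<^sub>R T 0 \<in> nc_toeplitz_algebra"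
    by (intro nc_toeplitz_algebra_scaleR assms)
  then show "(\<Sum>k<n. T k) \<in> nc_toeplitz_algebra" for n
    by (induction n) (simp_all add: nc_toeplitz_algebra_add assms(2))
qed

lemma nc_toeplitz_algebra_op_pow:
  "T \<in> nc_toeplitz_algebra \<Longrightarrow> op_pow T k \<in> nc_toeplitz_algebra"
  by (induction k) (simp_all add: nc_toeplitz_algebra_id nc_toeplitz_algebra_compose)

section \<open>The proper factorization\<close>

theorem theorem2p6:
  fixes L X :: "'n::finite fock \<Rightarrow>\<^sub>L 'n fock"
  assumes "L \<in> nc_toeplitz_algebra" and "isometry_op L"
    and "X \<in> nc_toeplitz_algebra" and "isometry_op X"
    and "range (blinfun_apply X) \<subseteq> orthocomplement (range (blinfun_apply L))"
  shows "has_proper_factorization L"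
proof -
  interpret orthogonal_isometries X L
  proof
    show "norm (X x) = norm x" "norm (L x) = norm x" for x
      using assms(2,4) by (simp_all add: isometry_op_def)
    show "inner (X x) (L y) = 0" for x y
    proof -
      have "X x \<in> orthocomplement (range L)" using assms(5) by blast
      then have "inner (L y) (X x) = 0"
        by (simp add: orthocomplement_def inner_ell2_def)
      then show ?thesis by (simp add: inner_commute)
    qed
  qed
  have vacuum: "basis_vec [] \<noteq> (0 :: 'n fock)"
  proof
    assume "basis_vec [] = (0 :: 'n fock)"
    then have "coord (basis_vec [] :: 'n fock) [] = 0" by simp
    then show False by (simp add: basis_vec.rep_eq)
  qed
  have "left_factor \<in> nc_toeplitz_algebra"
    by (intro nc_toeplitz_algebra_sums[OF left_factor_sums] nc_toeplitz_algebra_scaleR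
        nc_toeplitz_algebra_op_pow assms)
  moreover have "orbit_op k \<in> nc_toeplitz_algebra" for k
    by (simp add: orbit_op_def nc_toeplitz_algebra_compose nc_toeplitz_algebra_op_pow assms)
  then have "right_factor \<in> nc_toeplitz_algebra"
    by (intro nc_toeplitz_algebra_sums[OF right_factor_sums] nc_toeplitz_algebra_scaleR)
  moreover have "\<not> invertible_op left_factor"
    using left_factor_not_invertible[OF vacuum] by (auto simp: invertible_op_def)
  moreover have "\<not> invertible_op right_factor"
  proof
    assume "invertible_op right_factor"
    then obtain S where "right_factor o\<^sub>L S = id_blinfun" by (auto simp: invertible_op_def)
    then have "right_factor (S y) = y" for y
      by (metis blinfun_apply_blinfun_compose blinfun_apply_id_blinfun)
    then have "surj right_factor" by (metis surjI)
    then show False using right_factor_not_surj[OF vacuum] by contradiction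
  qed
  ultimately show ?thesis
    unfolding has_proper_factorization_def using factorization by metis
qed

end
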